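(* Let $A$ be an abelian group and let $C=(c_1,\ldots,c_m)$ be a (finite) semiminimal family of elements of $A$. Let $r:=r(C)$ be the order of $C$. Then $$\chi_c(\operatorname{Cay}(A,C))\leq\begin{cases}2,&\text{if } r=\infty,\\[1mm] \dfrac{2r}{r-1},&\text{if } r\in\mathbb N.\end{cases}$$
   Context: A semiminimal family of a group $G$ is a well-ordered family $(c_\alpha)_{\alpha<\iota}$ of elements of $G$ (not necessarily generating $G$) such that $c_\alpha\notin\langle c_\beta:\beta<\alpha\rangle$ for every $\alpha<\iota$; here the index set is $\{1,\dots,m\}$ with its usual order. For a well-ordered family $C=(c_\alpha)$ of elements of an abelian group $A$, put $H_\alpha:=\langle c_\beta:\beta<\alpha\rangle$. The relative order of $c_\alpha$ in $C$ is $r_\alpha:=\operatorname{ord}_{A/H_\alpha}(c_\alpha+H_\alpha)\in\mathbb Z_{>0}\cup\{\infty\}$. The order of $C$ is $r(C):=\min_\alpha r_\alpha$, with $r(\varnothing):=\infty$. ($C$ is semiminimal if and only if $r(C)\ge 2$.) For a group $G$ and a family (or set) $C$ of elements of $G$, the undirected Cayley graph $\operatorname{Cay}(G,C)$ has vertex set $G$, with two distinct elements $a,b$ adjacent whenever $a^{-1}b\in C\cup C^{-1}$. $C$ is not required to generate $G$. The circular chromatic number $\chi_c(X)$ of a graph $X=(V,E)$ is the infimum of all real $s\ge 1$ for which there is a map $f:V\to\mathbb R/\mathbb Z$ such that for every edge $\{u,v\}$ the circular distance $\|f(u)-f(v)\|$ is at least $1/s$, where $\|x\|$ is the distance from $x\in\mathbb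 R/\mathbb Z$ to $0$ on the circle of circumference $1$. *)

theory Defs
  imports
    "HOL-Analysis.Analysis"
    "HOL-Algebra.Generated_Groups"
    "HOL-Algebra.Multiplicative_Group"
    "HOL-Library.Extended_Nat"
    "HOL-Library.Extended_Real"
begin

text \<open>
  A well-ordered family is a function \<open>c\<close> restricted to an index set \<open>I\<close> in a well-ordered type.
  Groups, including abelian ones, are written multiplicatively.
\<close>

definition preceding :: "('a, 'b) monoid_scheme \<Rightarrow> 'i::wellorder set \<Rightarrow> ('i \<Rightarrow> 'a) \<Rightarrow> 'i \<Rightarrow> 'a set"
  where "preceding G I c i = generate G (c ` {j \<in> I. j < i})"

definition semiminimal :: "('a, 'b) monoid_scheme \<Rightarrow> 'i::wellorder set \<Rightarrow> ('i \<Rightarrow> 'a) \<Rightarrow> bool"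
  where "semiminimal G I c \<longleftrightarrow> c ` I \<subseteq> carrier G \<and> (\<forall>i\<in>I. c i \<notin> preceding G I c i)"

text \<open>The library function \<open>group.ord\<close> yields \<open>0\<close> for elements of infinite order.\<close>

definition elem_order :: "('a, 'b) monoid_scheme \<Rightarrow> 'a \<Rightarrow> enat"
  where "elem_order G x = (if group.ord G x = 0 then \<infinity> else enat (group.ord G x))"

definition relative_order ::
    "('a, 'b) monoid_scheme \<Rightarrow> 'i::wellorder set \<Rightarrow> ('i \<Rightarrow> 'a) \<Rightarrow> 'i \<Rightarrow> enat"
  where "relative_order A I c i =
    elem_order (A Mod preceding A I c i) (preceding A I c i #>\<^bsub>A\<^esub> c i)"

text \<open>
  Infima in \<^typ>\<open>enat\<close> of nonempty sets are attained, and the infimum of the empty set is \<open>\<infinity>\<close>.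
\<close>

definition family_order :: "('a, 'b) monoid_scheme \<Rightarrow> 'i::wellorder set \<Rightarrow> ('i \<Rightarrow> 'a) \<Rightarrow> enat"
  where "family_order A I c = (INF i\<in>I. relative_order A I c i)"

text \<open>A graph is a pair of its vertex set and its set of (two-element) edges.\<close>

type_synonym 'v graph = "'v set \<times> 'v set set"

definition Cay :: "('a, 'b) monoid_scheme \<Rightarrow> 'a set \<Rightarrow> 'a graph"
  where "Cay G C =
    (carrier G,
     {{a, b} | a b. a \<in> carrier G \<and> b \<in> carrier G \<and> a \<noteq> b \<and>
        inv\<^bsub>G\<^esub> a \<otimes>\<^bsub>G\<^esub> b \<in> C \<union> set_inv\<^bsub>G\<^esub> C})"

quotient_type circle = real / "\<lambda>x y::real. x - y \<in> \<int>"
proof (rule equivpI)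
  show "reflp (\<lambda>x y::real. x - y \<in> \<int>)"
    by (auto intro: reflpI)
  show "symp (\<lambda>x y::real. x - y \<in> \<int>)"
    by (rule sympI) (metis Ints_minus minus_diff_eq)
  show "transp (\<lambda>x y::real. x - y \<in> \<int>)"
  proof (rule transpI)
    fix x y z :: real
    assume "x - y \<in> \<int>" "y - z \<in> \<int>"
    then have "(x - y) + (y - z) \<in> \<int>" by (rule Ints_add)
    then show "x - z \<in> \<int>" by simp
  qed
qed

lift_definition circle_diff :: "circle \<Rightarrow> circle \<Rightarrow> circle" is "(-)"
proof -
  fix x x' y y' :: real
  assume "x - x' \<in> \<int>" "y - y' \<in> \<int>"
  then have "(x - x') - (y - y') \<in> \<int>" by (rule Ints_diff)
  then show "(x - y) - (x' - y') \<in> \<int>" by (simp add: algebra_simps)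
qed

lemma infdist_Ints_le:
  fixes x y :: real
  assumes "x - y \<in> \<int>"
  shows "infdist x \<int> \<le> infdist y \<int>"
proof -
  have "infdist x \<int> \<le> dist y a" if "a \<in> \<int>" for a
  proof -
    have "a + (x - y) \<in> \<int>" using that assms by (rule Ints_add)
    then have "infdist x \<int> \<le> dist x (a + (x - y))" by (rule infdist_le)
    also have "\<dots> = dist y a" by (simp add: dist_real_def)
    finally show ?thesis .
  qed
  moreover have "(\<int> :: real set) \<noteq> {}" using Ints_0 by blast
  ultimately show ?thesis
    by (simp add: infdist_notempty[of \<int> y] cINF_greatest)
qed

text \<open>Distance to \<open>0\<close> on the circle: the distance of any representative to the nearest integer.\<close>

lift_definition circle_norm :: "circle \<Rightarrow> real" is "\<lambda>x. infdist x \<int>"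
  by (metis infdist_Ints_le Ints_minus minus_diff_eq order_antisym)

text \<open>
  The infimum is taken in the extended reals, so that it is \<open>\<infinity>\<close> (rather than unspecified) if no
  admissible \<open>s\<close> exists.
\<close>

definition circular_chromatic_number :: "'v graph \<Rightarrow> ereal"
  where "circular_chromatic_number X =
    Inf {ereal s | s. s \<ge> 1 \<and>
      (\<exists>f :: 'v \<Rightarrow> circle. \<forall>u\<in>fst X. \<forall>v\<in>fst X. {u, v} \<in> snd X \<longrightarrow>
         circle_norm (circle_diff (f u) (f v)) \<ge> 1 / s)}"

end

theory Submission
  imports Defs
begin

text \<open>
  A homomorphism \<open>\<phi>\<close> from \<open>A\<close> to the circle colours the Cayley graph: along an edge the colours
  differ by \<open>\<plusminus>\<phi> (c i)\<close>, so it is enough to keep every \<open>\<phi> (c i)\<close> far from \<open>0\<close>. Such a \<open>\<phi>\<close> is built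
  one generator at a time. Suppose that \<open>\<phi>\<close> is defined on the subgroup \<open>H\<close> generated by the
  generators before \<open>c i\<close>, and that \<open>c i\<close> has order \<open>n\<close> modulo \<open>H\<close>. The only constraint on the value
  \<open>x\<close> at \<open>c i\<close> is \<open>n x = \<phi> (c i ^ n)\<close> (\<open>additive_mod_one_extend\<close>). If \<open>n\<close> is infinite there is no
  constraint and \<open>x = 1/2\<close> is possible. If \<open>n\<close> is finite, the solutions are spaced \<open>1/n\<close> apart on
  the circle, so one of them is within \<open>1/(2n)\<close> of \<open>1/2\<close>, hence at distance at least
  \<open>1/2 - 1/(2n)\<close> from \<open>0\<close> (\<open>exists_root_mod_one_near_half\<close>). Since every \<open>n\<close> is at least \<open>r\<close>, all
  generators are at distance at least \<open>1/2 - 1/(2r) = (r - 1)/(2r)\<close>, the reciprocal of the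
  claimed bound (\<open>exists_additive_mod_one_avoiding_Ints\<close>).

  This defines \<open>\<phi>\<close> only on the subgroup generated by \<open>C\<close>, but no edge leaves a coset of that
  subgroup, so each coset can be coloured by a translate of \<open>\<phi>\<close>, independently of the others
  (\<open>circular_chromatic_number_Cay_le\<close>).
\<close>

section \<open>Additive maps modulo one\<close>

text \<open>
  Homomorphisms into the circle \<open>\<real>/\<int>\<close> are represented by real-valued lifts: roots can then be
  taken by real division, and closeness to \<open>1/2\<close> is an ordinary inequality.
\<close>

definition additive_mod_one :: "('a, 'b) monoid_scheme \<Rightarrow> 'a set \<Rightarrow> ('a \<Rightarrow> real) \<Rightarrow> bool"
  where "additive_mod_one G H \<phi> \<longleftrightarrow>
    (\<forall>x\<in>H. \<forall>y\<in>H. \<phi> (x \<otimes>\<^bsub>G\<^esub> y) - (\<phi> x + \<phi> y) \<in> \<int>)"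

lemma additive_mod_oneD:
  "\<lbrakk>additive_mod_one G H \<phi>; x \<in> H; y \<in> H\<rbrakk> \<Longrightarrow> \<phi> (x \<otimes>\<^bsub>G\<^esub> y) - (\<phi> x + \<phi> y) \<in> \<int>"
  by (simp add: additive_mod_one_def)

lemma (in group) additive_mod_one_one:
  assumes "subgroup H G" "additive_mod_one G H \<phi>"
  shows "\<phi> \<one> \<in> \<int>"
  using Ints_minus[OF additive_mod_oneD[OF assms(2), of \<one> \<one>]] subgroup.one_closed[OF assms(1)]
  by simp

lemma (in group) additive_mod_one_inv:
  assumes "subgroup H G" "additive_mod_one G H \<phi>" "x \<in> H"
  shows "\<phi> (inv x) + \<phi> x \<in> \<int>"
proof -
  have "inv x \<in> H" and [simp]: "x \<in> carrier G"
    using assms subgroup.m_inv_closed subgroup.mem_carrier by metis+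
  then have "\<phi> \<one> - (\<phi> (inv x) + \<phi> x) \<in> \<int>"
    using additive_mod_oneD[OF assms(2), of "inv x" x] assms(3) by simp
  from Ints_diff[OF additive_mod_one_one[OF assms(1,2)] this] show ?thesis by simp
qed

lemma (in group) additive_mod_one_int_pow:
  assumes "subgroup H G" "additive_mod_one G H \<phi>" "x \<in> H"
  shows "\<phi> (x [^] (k::int)) - of_int k * \<phi> x \<in> \<int>"
proof -
  have x: "x \<in> carrier G" using assms subgroup.mem_carrier by metis
  have nat_pow: "\<phi> (x [^] int n) - real n * \<phi> x \<in> \<int>" for n
  proof (induction n)
    case 0
    then show ?case using additive_mod_one_one[OF assms(1,2)] by simp
  next
    case (Suc n)
    have "x [^] int n \<in> H" by (rule subgroup_int_pow_closed[OF assms(1,3)])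
    from additive_mod_oneD[OF assms(2) this assms(3)]
    have "\<phi> (x [^] int (Suc n)) - (\<phi> (x [^] int n) + \<phi> x) \<in> \<int>"
      using int_pow_mult[OF x, of "int n" 1] x by (simp add: add.commute)
    from Ints_add[OF this Suc] show ?case by (simp add: algebra_simps)
  qed
  show ?thesis
  proof (cases k rule: int_cases2)
    case (nonneg n)
    then show ?thesis using nat_pow by simp
  next
    case (nonpos n)
    have "x [^] int n \<in> H" by (rule subgroup_int_pow_closed[OF assms(1,3)])
    from additive_mod_one_inv[OF assms(1,2) this]
    have "\<phi> (x [^] k) + \<phi> (x [^] int n) \<in> \<int>" using nonpos x by (simp add: int_pow_neg)
    from Ints_diff[OF this nat_pow[of n]] show ?thesis
      using nonpos by (simp add: algebra_simps)
  qed
qed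

section \<open>Extension by one element\<close>

lemma (in comm_group) generate_insert_subset:
  assumes "S \<subseteq> carrier G" "c \<in> carrier G"
  shows "generate G (insert c S) \<subseteq> {h \<otimes> c [^] (k::int) | h k. h \<in> generate G S}"
proof -
  let ?P = "generate G S <#> generate G {c}"
  have S: "subgroup (generate G S) G" and c: "subgroup (generate G {c}) G"
    using assms by (auto intro: generate_is_subgroup)
  have "s \<in> ?P" if "s \<in> S" for s
    using that assms generate.incl[of s S G] generate.one[of G "{c}"] r_one[of s]
    unfolding set_mult_def by force
  moreover have "c \<in> ?P"
    using assms generate.incl[of c "{c}" G] generate.one[of G S] l_one[of c]
    unfolding set_mult_def by force
  ultimately have "generate G (insert c S) \<subseteq> ?P"
    using mult_subgroups[OF S c] by (intro generate_subgroup_incl) auto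
  then show ?thesis
    unfolding set_mult_def generate_pow[OF assms(2)] by fast
qed

lemma (in comm_group) ord_Mod_dvd_iff:
  assumes "subgroup H G" "c \<in> carrier G"
  shows "int (group.ord (G Mod H) (H #> c)) dvd k \<longleftrightarrow> c [^] k \<in> H"
proof -
  interpret normal H G by (rule subgroup_imp_normal[OF assms(1)])
  have "int (group.ord (G Mod H) (H #> c)) dvd k \<longleftrightarrow> (H #> c) [^]\<^bsub>G Mod H\<^esub> k = H"
    using group.int_pow_eq_id[OF factorgroup_is_group, of "H #> c" k] assms(2)
    by (simp add: carrier_FactGroup)
  also have "\<dots> \<longleftrightarrow> H #> c [^] k = H" by (simp add: FactGroup_int_pow assms(2))
  also have "\<dots> \<longleftrightarrow> c [^] k \<in> H"
    using coset_join1[OF _ _ assms(1)] coset_join2[OF _ assms(1)] assms(2) by blast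
  finally show ?thesis .
qed

text \<open>
  The relations between \<open>c\<close> and \<open>H\<close>, the subgroup generated by \<open>S\<close>, all follow from the one that
  places \<open>c ^ n\<close> in \<open>H\<close>, so the hypothesis on \<open>x\<close> makes \<open>h c ^ k \<mapsto> \<phi> h + k x\<close> independent, modulo
  one, of how an element is written. The library order is \<open>0\<close> for infinite order; then \<open>c ^ n\<close> is
  the identity and the hypothesis on \<open>x\<close> holds for every \<open>x\<close>, as it should.
\<close>

lemma (in comm_group) additive_mod_one_extend:
  assumes S: "S \<subseteq> carrier G" and c: "c \<in> carrier G"
    and \<phi>: "additive_mod_one G (generate G S) \<phi>"
    and n: "n = group.ord (G Mod generate G S) (generate G S #> c)"
    and x: "\<phi> (c [^] n) - real n * x \<in> \<int>"
  obtains \<psi> where "additive_mod_one G (generate G (insert c S)) \<psi>"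
    and "\<And>h. h \<in> generate G S \<Longrightarrow> \<psi> h - \<phi> h \<in> \<int>" and "\<psi> c - x \<in> \<int>"
proof -
  let ?H = "generate G S"
  have H: "subgroup ?H G" by (rule generate_is_subgroup[OF S])
  have carr: "h \<in> carrier G" if "h \<in> ?H" for h using that H subgroup.mem_carrier by metis
  have dvd: "int n dvd k \<longleftrightarrow> c [^] k \<in> ?H" for k :: int
    unfolding n by (rule ord_Mod_dvd_iff[OF H c])
  have pow: "\<phi> (c [^] k) - of_int k * x \<in> \<int>" if "c [^] k \<in> ?H" for k :: int
  proof -
    obtain l where l: "k = int n * l" using \<open>c [^] k \<in> ?H\<close> unfolding dvd[symmetric] by (rule dvdE)
    have ck: "c [^] k = (c [^] int n) [^] l" by (simp only: l int_pow_pow[OF c])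
    have cn: "c [^] int n \<in> ?H" by (rule iffD1[OF dvd dvd_refl])
    have "\<phi> (c [^] k) - of_int l * \<phi> (c [^] n) \<in> \<int>"
      using additive_mod_one_int_pow[OF H \<phi> cn, of l] unfolding ck int_pow_int .
    from Ints_add[OF this Ints_mult[OF Ints_of_int[of l] x]]
    show ?thesis by (simp add: l algebra_simps)
  qed
  \<comment> \<open>An arbitrary way of writing \<open>g\<close> as \<open>h c ^ k\<close>; other ways change the value by an integer.\<close>
  define rep where "rep g = (SOME p. fst p \<in> ?H \<and> g = fst p \<otimes> c [^] (snd p :: int))" for g
  define \<psi> where "\<psi> g = \<phi> (fst (rep g)) + of_int (snd (rep g)) * x" for g
  have \<psi>: "\<psi> (h \<otimes> c [^] k) - (\<phi> h + of_int k * x) \<in> \<int>" if h: "h \<in> ?H" for h and k :: int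
  proof -
    define h' k' where "h' = fst (rep (h \<otimes> c [^] k))" and "k' = snd (rep (h \<otimes> c [^] k))"
    have *: "h' \<in> ?H" "h \<otimes> c [^] k = h' \<otimes> c [^] k'"
      using someI[of "\<lambda>p. fst p \<in> ?H \<and> h \<otimes> c [^] k = fst p \<otimes> c [^] (snd p :: int)" "(h, k)"] h
      unfolding h'_def k'_def rep_def by auto
    have [simp]: "h \<in> carrier G" "h' \<in> carrier G" using h *(1) carr by auto
    have "h \<otimes> c [^] (k - k') = h \<otimes> c [^] k \<otimes> inv (c [^] k')"
      using c by (simp add: int_pow_diff m_assoc)
    also have "\<dots> = h'" using c by (simp add: *(2) m_assoc)
    finally have h': "h' = h \<otimes> c [^] (k - k')" by simp
    then have "c [^] (k - k') = inv h \<otimes> h'" using c by (simp add: m_assoc[symmetric])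
    then have mem: "c [^] (k - k') \<in> ?H"
      using H h *(1) subgroup.m_closed subgroup.m_inv_closed by metis
    have "\<phi> h' - (\<phi> h + \<phi> (c [^] (k - k'))) \<in> \<int>"
      using additive_mod_oneD[OF \<phi> h mem] by (simp add: h')
    from Ints_add[OF this pow[OF mem]] show ?thesis
      by (simp add: \<psi>_def h'_def k'_def algebra_simps)
  qed
  show thesis
  proof
    show "additive_mod_one G (generate G (insert c S)) \<psi>"
      unfolding additive_mod_one_def
    proof (intro ballI)
      fix u v assume "u \<in> generate G (insert c S)" "v \<in> generate G (insert c S)"
      then obtain h k h' k' where u: "u = h \<otimes> c [^] (k::int)" "h \<in> ?H"
        and v: "v = h' \<otimes> c [^] (k'::int)" "h' \<in> ?H"
        using generate_insert_subset[OF S c] by blast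
      have hh: "h \<otimes> h' \<in> ?H" using H u v subgroup.m_closed by metis
      have "u \<otimes> v = (h \<otimes> h') \<otimes> c [^] (k + k')"
        using carr[OF u(2)] carr[OF v(2)] c by (simp add: u v int_pow_mult m_ac)
      then have "\<psi> (u \<otimes> v) - (\<phi> (h \<otimes> h') + of_int (k + k') * x) \<in> \<int>"
        using \<psi>[OF hh, of "k + k'"] by (simp only:)
      from Ints_diff[OF Ints_add[OF this additive_mod_oneD[OF \<phi> u(2) v(2)]]
          Ints_add[OF \<psi>[OF u(2), of k] \<psi>[OF v(2), of k']]]
      show "\<psi> (u \<otimes> v) - (\<psi> u + \<psi> v) \<in> \<int>" by (simp add: u(1) v(1) algebra_simps)
    qed
    show "\<psi> h - \<phi> h \<in> \<int>" if "h \<in> ?H" for h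
      using \<psi>[OF that, of 0] carr[OF that] by simp
    have "\<psi> c - (\<phi> \<one> + x) \<in> \<int>"
      using \<psi>[OF subgroup.one_closed[OF H], of 1] c by simp
    from Ints_add[OF this additive_mod_one_one[OF H \<phi>]] show "\<psi> c - x \<in> \<int>" by simp
  qed
qed

section \<open>Staying far from the integers\<close>

text \<open>
  The case \<open>n = 0\<close> covers infinite order: the constraint is void and, because \<open>1 / 0 = 0\<close>, the
  bound forces \<open>x = 1/2\<close>.
\<close>

lemma exists_root_mod_one_near_half:
  fixes \<theta> :: real
  assumes "n = 0 \<Longrightarrow> \<theta> \<in> \<int>"
  obtains x where "\<theta> - real n * x \<in> \<int>" "\<bar>x - 1/2\<bar> \<le> 1 / (2 * real n)"
proof (cases "n = 0")
  case True
  then show ?thesis using assms that[of "1/2"] by simp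
next
  case False
  \<comment> \<open>\<open>(\<theta> + k) / n\<close> is nearest to \<open>1/2\<close> when \<open>\<theta> + k\<close> is nearest to \<open>n/2\<close>.\<close>
  define k :: int where "k = round (real n / 2 - \<theta>)"
  define x where "x = (\<theta> + of_int k) / real n"
  have "\<bar>of_int k - (real n / 2 - \<theta>)\<bar> \<le> 1/2"
    unfolding k_def by (rule of_int_round_abs_le)
  moreover have "x - 1/2 = (of_int k - (real n / 2 - \<theta>)) / real n"
    using False by (simp add: x_def field_simps)
  ultimately have "\<bar>x - 1/2\<bar> \<le> 1 / (2 * real n)"
    using False by (simp add: divide_simps)
  moreover have "\<theta> - real n * x \<in> \<int>" using False by (simp add: x_def)
  ultimately show ?thesis using that by blast
qed

lemma infdist_Ints_half: "infdist (1/2) (\<int> :: real set) \<ge> 1/2"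
proof -
  have "1/2 \<le> dist (1/2) z" if "z \<in> \<int>" for z :: real
  proof -
    obtain i where i: "z = of_int i" using \<open>z \<in> \<int>\<close> by (rule Ints_cases)
    have "i \<le> 0 \<or> i \<ge> 1" by linarith
    then have "z \<le> 0 \<or> z \<ge> 1" by (simp add: i)
    then show ?thesis by (auto simp: dist_real_def)
  qed
  moreover have "(\<int> :: real set) \<noteq> {}" using Ints_0 by blast
  ultimately show ?thesis unfolding infdist_notempty[OF \<open>\<int> \<noteq> {}\<close>] by (intro cINF_greatest)
qed

lemma infdist_Ints_ge: "infdist x \<int> \<ge> 1/2 - \<bar>x - 1/2\<bar>" for x :: real
  using infdist_triangle[of "1/2" \<int> x] infdist_Ints_half by (simp add: dist_real_def abs_minus_commute)

lemma infdist_Ints_cong: "x - y \<in> \<int> \<Longrightarrow> infdist x \<int> = infdist y \<int>" for x y :: real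
  by (metis infdist_Ints_le Ints_minus minus_diff_eq order_antisym)

lemma infdist_Ints_minus: "infdist (- x) \<int> = infdist x \<int>" for x :: real
proof -
  have "infdist (- x) \<int> \<le> infdist x \<int>" for x :: real
  proof -
    have "infdist (- x) \<int> \<le> dist x a" if "a \<in> \<int>" for a
      using infdist_le[OF Ints_minus[OF that], of "- x"] by (simp add: dist_minus)
    moreover have "(\<int> :: real set) \<noteq> {}" using Ints_0 by blast
    ultimately show ?thesis by (simp add: infdist_notempty[of \<int> x] cINF_greatest)
  qed
  from this[of x] this[of "- x"] show ?thesis by simp
qed

text \<open>
  Adding a new largest index leaves the relative orders of the earlier indices unchanged, and
  the extended map agrees modulo one with the old one on the earlier generators. So the bounds
  obtained before survive, and only the new generator needs attention.
\<close>

lemma (in comm_group) exists_additive_mod_one_avoiding_Ints: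
  fixes c :: "'i::wellorder \<Rightarrow> 'a"
  assumes "finite I" "c ` I \<subseteq> carrier G"
  shows "\<exists>\<phi>. additive_mod_one G (generate G (c ` I)) \<phi> \<and>
    (\<forall>i\<in>I. infdist (\<phi> (c i)) \<int> \<ge>
      1/2 - 1 / (2 * real (group.ord (G Mod preceding G I c i) (preceding G I c i #> c i))))"
  using assms
proof (induction I rule: finite_linorder_max_induct)
  case empty
  show ?case by (rule exI[of _ "\<lambda>_. 0"]) (simp add: additive_mod_one_def)
next
  case (insert b I)
  let ?ord = "\<lambda>I i. group.ord (G Mod preceding G I c i) (preceding G I c i #> c i)"
  let ?H = "generate G (c ` I)"
  have I: "c ` I \<subseteq> carrier G" and b: "c b \<in> carrier G" using insert.prems by auto
  obtain \<phi> where \<phi>: "additive_mod_one G ?H \<phi>"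
    and far: "\<And>i. i \<in> I \<Longrightarrow> infdist (\<phi> (c i)) \<int> \<ge> 1/2 - 1 / (2 * real (?ord I i))"
    using insert.IH[OF I] by blast
  have H: "subgroup ?H G" by (rule generate_is_subgroup[OF I])
  have below: "{j \<in> insert b I. j < i} = {j \<in> I. j < i}" if "i \<in> I" for i
    using insert.hyps that by force
  have "{j \<in> insert b I. j < b} = I"
    using insert.hyps by force
  then have top: "preceding G (insert b I) c b = ?H" by (simp add: preceding_def)
  define n where "n = group.ord (G Mod ?H) (?H #> c b)"
  have "\<phi> (c b [^] n) \<in> \<int>" if "n = 0"
    using that additive_mod_one_one[OF H \<phi>] by simp
  then obtain x where x: "\<phi> (c b [^] n) - real n * x \<in> \<int>" "\<bar>x - 1/2\<bar> \<le> 1 / (2 * real n)"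
    by (rule exists_root_mod_one_near_half)
  obtain \<psi> where \<psi>: "additive_mod_one G (generate G (insert (c b) (c ` I))) \<psi>"
    and old: "\<And>h. h \<in> ?H \<Longrightarrow> \<psi> h - \<phi> h \<in> \<int>" and new: "\<psi> (c b) - x \<in> \<int>"
    using additive_mod_one_extend[OF I b \<phi> n_def x(1)] by blast
  have "infdist (\<psi> (c i)) \<int> \<ge> 1/2 - 1 / (2 * real (?ord (insert b I) i))"
    if "i \<in> insert b I" for i
  proof (cases "i \<in> I")
    case True
    then have "infdist (\<psi> (c i)) \<int> = infdist (\<phi> (c i)) \<int>"
      by (intro infdist_Ints_cong old generate.incl) simp
    then show ?thesis using far[OF True] unfolding preceding_def below[OF True] by simp
  next
    case False
    then have "i = b" using that by simp
    moreover have "infdist (\<psi> (c b)) \<int> = infdist x \<int>" by (rule infdist_Ints_cong[OF new])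
    ultimately show ?thesis using infdist_Ints_ge[of x] x(2) by (simp add: top n_def)
  qed
  then show ?case using \<psi> by auto
qed

section \<open>Circular colourings of Cayley graphs\<close>

lemma circle_norm_circle_diff:
  "circle_norm (circle_diff (abs_circle x) (abs_circle y)) = infdist (x - y) \<int>"
  by (simp add: circle_diff.abs_eq circle_norm.abs_eq)

text \<open>
  The vertex \<open>a\<close> receives the colour of the element that carries the representative of its coset
  to \<open>a\<close>. Adjacent vertices have the same representative, which cancels in the difference.
\<close>

lemma (in comm_group) circular_chromatic_number_Cay_le:
  assumes C: "C \<subseteq> carrier G" and \<phi>: "additive_mod_one G (generate G C) \<phi>"
    and s: "s \<ge> 1" and far: "\<And>x. x \<in> C \<Longrightarrow> infdist (\<phi> x) \<int> \<ge> 1 / s"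
  shows "circular_chromatic_number (Cay G C) \<le> ereal s"
proof -
  let ?H = "generate G C"
  have H: "subgroup ?H G" by (rule generate_is_subgroup[OF C])
  define rep where "rep X = (SOME y. y \<in> X)" for X :: "'a set"
  define f where "f a = \<phi> (a \<otimes> inv (rep (?H #> a)))" for a
  have diff: "infdist (f a - f b) \<int> \<ge> 1 / s"
    if ab: "a \<in> carrier G" "b \<in> carrier G" and x: "x \<in> C" "b = a \<otimes> x" for a b x
  proof -
    define t where "t = rep (?H #> a)"
    have xH: "x \<in> ?H" and xG: "x \<in> carrier G" using x C by (auto intro: generate.incl)
    have "b \<in> ?H #> a" using xH m_comm[OF ab(1) xG] by (auto simp: r_coset_def x(2))
    then have coset: "?H #> b = ?H #> a" using repr_independence[OF _ ab(1) H] by simp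
    have "t \<in> ?H #> a"
      unfolding t_def rep_def using rcos_self[OF ab(1) H] by (rule someI)
    then obtain h where h: "h \<in> ?H" "t = h \<otimes> a" by (auto simp: r_coset_def)
    have hG: "h \<in> carrier G" using h(1) H subgroup.mem_carrier by metis
    have tG: "t \<in> carrier G" using hG ab(1) h(2) by simp
    have at: "a \<otimes> inv t = inv h" using hG ab(1) by (simp add: h(2) inv_mult_group m_assoc[symmetric])
    then have atH: "a \<otimes> inv t \<in> ?H" using h(1) H subgroup.m_inv_closed by metis
    have "b \<otimes> inv t = (a \<otimes> inv t) \<otimes> x"
      using ab(1) xG tG by (simp add: x(2) m_ac)
    then have "f b - (f a + \<phi> x) \<in> \<int>"
      using additive_mod_oneD[OF \<phi> atH xH] by (simp add: f_def coset t_def)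
    then have "(f b - f a) - \<phi> x \<in> \<int>" by (simp add: algebra_simps)
    then have "infdist (f b - f a) \<int> = infdist (\<phi> x) \<int>" by (rule infdist_Ints_cong)
    then show ?thesis using far[OF x(1)] infdist_Ints_minus[of "f a - f b"] by simp
  qed
  have edge: "infdist (f u - f v) \<int> \<ge> 1 / s"
    if uv: "u \<in> carrier G" "v \<in> carrier G" and "inv u \<otimes> v \<in> C \<union> set_inv C" for u v
  proof -
    from that consider "inv u \<otimes> v \<in> C" | x where "x \<in> C" "inv u \<otimes> v = inv x"
      by (auto simp: SET_INV_def)
    then show ?thesis
    proof cases
      case 1
      show ?thesis by (rule diff[OF uv 1]) (use uv in \<open>simp add: m_assoc[symmetric]\<close>)
    next
      case 2
      then have x: "x \<in> carrier G" using C by auto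
      have "x = inv (inv u \<otimes> v)" using 2 x by simp
      then have "u = v \<otimes> x" using uv by (simp add: inv_mult_group m_assoc[symmetric])
      from diff[OF uv(2,1) 2(1) this] show ?thesis
        using infdist_Ints_minus[of "f u - f v"] by simp
    qed
  qed
  have "1 / s \<le> circle_norm (circle_diff (abs_circle (f u)) (abs_circle (f v)))"
    if "{u, v} \<in> snd (Cay G C)" for u v
  proof -
    obtain a b where ab: "{u, v} = {a, b}" "a \<in> carrier G" "b \<in> carrier G"
      "inv a \<otimes> b \<in> C \<union> set_inv C"
      using \<open>{u, v} \<in> snd (Cay G C)\<close> unfolding Cay_def snd_conv by blast
    have "(u = a \<and> v = b) \<or> (u = b \<and> v = a)" using ab(1) by (auto simp: doubleton_eq_iff)
    then show ?thesis
      using edge[OF ab(2-4)] infdist_Ints_minus[of "f a - f b"]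
      by (auto simp: circle_norm_circle_diff)
  qed
  then show ?thesis
    unfolding circular_chromatic_number_def
    by (intro Inf_lower CollectI exI[of _ s] conjI exI[of _ "\<lambda>a. abs_circle (f a)"]) (use s in auto)
qed

text \<open>
  Relative order \<open>1\<close> would place \<open>c i\<close> in the subgroup generated by its predecessors. For the
  main bound this guarantees \<open>r - 1 > 0\<close>.
\<close>

lemma (in comm_group) two_le_family_order:
  assumes "semiminimal G I c"
  shows "2 \<le> family_order G I c"
  unfolding family_order_def
proof (rule INF_greatest)
  fix i assume i: "i \<in> I"
  let ?H = "preceding G I c i"
  have "c i \<in> carrier G" "c i \<notin> ?H" "c ` {j \<in> I. j < i} \<subseteq> carrier G"
    using assms i by (auto simp: semiminimal_def)
  then have "group.ord (G Mod ?H) (?H #> c i) \<noteq> 1"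
    using ord_Mod_dvd_iff[of ?H "c i" 1] generate_is_subgroup by (auto simp: preceding_def)
  then show "2 \<le> relative_order G I c i"
    by (auto simp: relative_order_def elem_order_def numeral_eq_enat)
qed

theorem theorem2p3:
  fixes A :: "('a, 'b) monoid_scheme" and c :: "nat \<Rightarrow> 'a" and m :: nat
  assumes "comm_group A"
    and "semiminimal A {1..m} c"
  shows "circular_chromatic_number (Cay A (c ` {1..m})) \<le>
    (case family_order A {1..m} c of
       \<infinity> \<Rightarrow> 2
     | enat r \<Rightarrow> ereal (2 * real r / (real r - 1)))"
proof -
  interpret comm_group A by fact
  let ?I = "{1..m}"
  let ?ord = "\<lambda>i. group.ord (A Mod preceding A ?I c i) (preceding A ?I c i #>\<^bsub>A\<^esub> c i)"
  have C: "c ` ?I \<subseteq> carrier A" using assms(2) by (simp add: semiminimal_def)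
  obtain \<phi> where \<phi>: "additive_mod_one A (generate A (c ` ?I)) \<phi>"
    and far: "\<And>i. i \<in> ?I \<Longrightarrow> infdist (\<phi> (c i)) \<int> \<ge> 1/2 - 1 / (2 * real (?ord i))"
    using exists_additive_mod_one_avoiding_Ints[OF _ C] by auto
  have le: "family_order A ?I c \<le> (if ?ord i = 0 then \<infinity> else enat (?ord i))" if "i \<in> ?I" for i
    unfolding family_order_def relative_order_def elem_order_def
    using that by (rule INF_lower)
  show ?thesis
  proof (cases "family_order A ?I c")
    case (enat r)
    have r: "r \<ge> 2" using two_le_family_order[OF assms(2)] enat by (simp add: numeral_eq_enat)
    have "infdist (\<phi> x) \<int> \<ge> 1 / (2 * real r / (real r - 1))" if "x \<in> c ` ?I" for x
    proof -
      obtain i where i: "i \<in> ?I" "x = c i" using \<open>x \<in> c ` ?I\<close> by auto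
      have "1 / (2 * real (?ord i)) \<le> 1 / (2 * real r)"
        using le[OF i(1)] r unfolding enat
        by (cases "?ord i = 0") (auto intro!: divide_left_mono simp del: One_nat_def)
      moreover have "1 / (2 * real r / (real r - 1)) = 1/2 - 1 / (2 * real r)"
        using r by (simp add: field_simps)
      ultimately show ?thesis using far[OF i(1)] unfolding i(2) by linarith
    qed
    moreover have "2 * real r / (real r - 1) \<ge> 1" using r by (simp add: field_simps)
    ultimately have "circular_chromatic_number (Cay A (c ` ?I))
        \<le> ereal (2 * real r / (real r - 1))"
      by (intro circular_chromatic_number_Cay_le[OF C \<phi>])
    then show ?thesis unfolding enat by simp
  next
    case infinity
    have "infdist (\<phi> x) \<int> \<ge> 1 / 2" if "x \<in> c ` ?I" for x
    proof -
      obtain i where i: "i \<in> ?I" "x = c i" using \<open>x \<in> c ` ?I\<close> by auto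
      have "?ord i = 0" using le[OF i(1)] unfolding infinity by (auto split: if_splits)
      then show ?thesis using far[OF i(1)] i(2) by simp
    qed
    then have "circular_chromatic_number (Cay A (c ` ?I)) \<le> ereal 2"
      by (intro circular_chromatic_number_Cay_le[OF C \<phi>]) simp_all
    then show ?thesis unfolding infinity by simp
  qed
qed

end
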